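(* Let $N,k\in\mathbb N$ and $\tau>0$, and let $U\sim\mathrm U(N)$ denote the Haar measure. Then the query complexity of non-trivial learning states $\rho(U)=U|0\rangle\langle0|U^\dagger$ with respect to $U\sim\mathrm U(N)$ from $k$-copy quantum statistical queries satisfies $$q_{\mathrm{nt}}\big[(\mathbb S^{N-1})^{\odot k},\tau\big]\ge\exp\left(\frac{N\tau^2}{9\pi^3k^2}\right).$$
   Context: The $k$-copy oracle $\mathtt{QStat}^{(k)}_\tau(\rho)$, queried with a Hermitian $O$ on $(\mathbb C^N)^{\otimes k}$ with $\|O\|_{\mathrm{op}}\le1$, returns some $v$ with $|v-\mathrm{tr}[\rho^{\otimes k}O]|\le\tau$. The query complexity of non-trivial learning is $q_{\mathrm{nt}}[(\mathbb S^{N-1})^{\odot k},\tau]=\sup_g\big(\sup_O\Pr_{U\sim\mathrm U(N)}[|\mathrm{tr}[\rho(U)^{\otimes k}O]-g(O)|>\tau]\big)^{-1}$, where $O$ ranges over Hermitian operators on $(\mathbb C^N)^{\otimes k}$ with $\|O\|_{\mathrm{op}}\le1$ and $g$ over real-valued functions on that set. *)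

theory Defs
  imports "HOL-Probability.Probability"
begin

definition cadj :: "complex^'n^'n \<Rightarrow> complex^'n^'n" where
  "cadj U = (\<chi> i j. cnj (U $ j $ i))"

definition unitary_mat :: "complex^'n^'n \<Rightarrow> bool" where
  "unitary_mat U \<longleftrightarrow> U ** cadj U = mat 1 \<and> cadj U ** U = mat 1"

text \<open>Haar probability measure on U(N): a Borel probability measure on matrices,
  concentrated on the unitary group, invariant under left multiplication by unitaries.
  (Such a measure exists and is unique.)\<close>
definition haar_unitary :: "(complex^'n^'n) measure \<Rightarrow> bool" where
  "haar_unitary \<mu> \<longleftrightarrow> prob_space \<mu> \<and> sets \<mu> = sets borel \<and>
     measure \<mu> {U. unitary_mat U} = 1 \<and>
     (\<forall>V. unitary_mat V \<longrightarrow> distr \<mu> \<mu> (\<lambda>U. V ** U) = \<mu>)"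

text \<open>Basis of (C^N)^{\<otimes>k}: words of length k over 'n.\<close>
definition tidx :: "nat \<Rightarrow> 'n list set" where
  "tidx k = {xs. length xs = k}"

type_synonym 'n kop = "'n list \<Rightarrow> 'n list \<Rightarrow> complex"

definition apply_op :: "nat \<Rightarrow> 'n kop \<Rightarrow> ('n list \<Rightarrow> complex) \<Rightarrow> 'n list \<Rightarrow> complex" where
  "apply_op k Q v = (\<lambda>xs. \<Sum>ys\<in>tidx k. Q xs ys * v ys)"

definition hermitian_op :: "nat \<Rightarrow> 'n kop \<Rightarrow> bool" where
  "hermitian_op k Q \<longleftrightarrow> (\<forall>xs\<in>tidx k. \<forall>ys\<in>tidx k. Q xs ys = cnj (Q ys xs))"

definition opnorm_le1 :: "nat \<Rightarrow> 'n kop \<Rightarrow> bool" where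
  "opnorm_le1 k Q \<longleftrightarrow> (\<forall>v. (\<Sum>xs\<in>tidx k. (cmod (apply_op k Q v xs))\<^sup>2)
                              \<le> (\<Sum>xs\<in>tidx k. (cmod (v xs))\<^sup>2))"

definition obs :: "nat \<Rightarrow> 'n kop set" where
  "obs k = {Q. hermitian_op k Q \<and> opnorm_le1 k Q}"

definition rho :: "'n \<Rightarrow> complex^'n^'n \<Rightarrow> 'n \<Rightarrow> 'n \<Rightarrow> complex" where
  "rho i0 U = (\<lambda>a b. U $ a $ i0 * cnj (U $ b $ i0))"

definition tensor_pow :: "nat \<Rightarrow> ('n \<Rightarrow> 'n \<Rightarrow> complex) \<Rightarrow> 'n kop" where
  "tensor_pow k A = (\<lambda>xs ys. \<Prod>i<k. A (xs ! i) (ys ! i))"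

definition tr_prod :: "nat \<Rightarrow> 'n kop \<Rightarrow> 'n kop \<Rightarrow> complex" where
  "tr_prod k A Q = (\<Sum>xs\<in>tidx k. \<Sum>ys\<in>tidx k. A xs ys * Q ys xs)"

text \<open>Query complexity of non-trivial learning (inverse of 0 is infinity in ennreal).\<close>
definition q_nt :: "(complex^'n^'n) measure \<Rightarrow> 'n \<Rightarrow> nat \<Rightarrow> real \<Rightarrow> ennreal" where
  "q_nt \<mu> i0 k \<tau> = (SUP g :: 'n kop \<Rightarrow> real. inverse (SUP Q\<in>obs k.
      emeasure \<mu> {U\<in>space \<mu>. cmod (tr_prod k (tensor_pow k (rho i0 U)) Q - complex_of_real (g Q)) > \<tau>}))"

end

theory Submission
  imports Defs
begin

text \<open>For a fixed observable \<open>Q\<close> let \<open>f v = \<langle>v\<^sup>\<otimes>\<^sup>k|Q|v\<^sup>\<otimes>\<^sup>k\<rangle>\<close>, whose derivative at a unit vector has norm at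
  most \<open>2k\<close>. Two independent uniformly random unit vectors lie, up to a phase that \<open>f\<close> ignores, on a great
  circle through two columns of a Haar unitary \<open>U\<close>. Cutting the arc between them into \<open>n\<close> pieces with
  identically distributed increments, convexity of \<open>exp\<close> and \<open>n \<rightarrow> \<infinity>\<close> bound the moment generating
  function of the difference of their \<open>f\<close>-values by that of the derivative of \<open>f\<close> at one column in the
  direction of the other. By invariance this direction may be replaced by a random sign combination
  of all other columns, so that the derivative becomes a Rademacher sum with variance at most
  \<open>4k\<^sup>2 / (N - 1)\<close>. This yields a centre \<open>g\<close> with \<open>P(|f - g| > t) \<le> 2 exp(- N t\<^sup>2 / (4\<pi>\<^sup>2k\<^sup>2))\<close>, which
  gives the claim if \<open>N \<tau>\<^sup>2 \<ge> 36 k\<^sup>2\<close>. For smaller \<open>\<tau>\<close> the factor \<open>2\<close> is too costly; there \<open>f\<close> lies with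
  probability at least \<open>1/2\<close> in an interval of radius \<open>8k / \<surd>N\<close>, and by the pigeonhole principle some
  interval of radius \<open>\<tau>\<close> already has sufficiently large probability.\<close>

section \<open>Unitary matrices\<close>

text \<open>The full complex inner product, antilinear on the left. The built-in real
  \<open>inner\<close> keeps only its real part, which does not determine a pair of unit vectors up
  to unitaries.\<close>

definition cip :: "complex^'n \<Rightarrow> complex^'n \<Rightarrow> complex" where
  "cip x y = (\<Sum>i\<in>UNIV. cnj (x $ i) * y $ i)"

lemma cip_self: "cip x x = of_real ((norm x)\<^sup>2)"
  unfolding cip_def norm_vec_def L2_set_def
  by (simp add: sum_nonneg complex_norm_square mult.commute del: of_real_power)

lemma norm_eq_1_if_cip:
  assumes "cip x x = 1" shows "norm x = 1"
proof -
  have "(norm x)\<^sup>2 = 1" using assms by (simp add: cip_self flip: of_real_power)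
  then show ?thesis using norm_ge_zero[of x] by (auto simp: power2_eq_1_iff)
qed

lemma cnj_cip: "cnj (cip x y) = cip y x"
  by (simp add: cip_def mult.commute)

lemma cip_diff_left: "cip (x - y) z = cip x z - cip y z"
  and cip_diff_right: "cip z (x - y) = cip z x - cip z y"
  and cip_scale_left: "cip (c *s x) z = cnj c * cip x z"
  and cip_scale_right: "cip z (c *s x) = c * cip z x"
  by (simp_all add: cip_def algebra_simps sum_subtractf sum_distrib_left)

lemma cip_add_left: "cip (x + y) z = cip x z + cip y z"
  and cip_add_right: "cip z (x + y) = cip z x + cip z y"
  by (simp_all add: cip_def algebra_simps sum.distrib)

lemma cip_scaleR_left: "cip (r *\<^sub>R x) z = of_real r * cip x z"
  and cip_scaleR_right: "cip z (r *\<^sub>R x) = of_real r * cip z x"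
  by (simp_all add: cip_def sum_distrib_left vector_scaleR_component scaleR_conv_of_real[where 'a=complex] mult_ac)

lemma cip_axis_left: "cip (axis i 1) y = y $ i"
  by (simp add: cip_def axis_def if_distrib[of cnj] if_distrib[of "\<lambda>x. x * _"] cong: if_cong)

lemma norm_axis_complex [simp]: "norm (axis i 1 :: complex^'n) = 1"
  using cip_self[of "axis i 1 :: complex^'n"]
  by (simp add: cip_axis_left flip: of_real_power)

lemma matrix_vector_mult_axis: "((U :: complex^'n^'m) *v axis j 1) $ i = U $ i $ j"
  by (simp add: matrix_vector_mult_def axis_def if_distrib[of "\<lambda>x. _ * x"] cong: if_cong)

lemma cip_adjoint: "cip (A *v x) y = cip x (cadj A *v y)"
  by (simp add: cip_def cadj_def matrix_vector_mult_def sum_distrib_left sum_distrib_right mult_ac)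
     (rule sum.swap)

lemma cadj_cadj [simp]: "cadj (cadj A) = A"
  by (simp add: cadj_def)

lemma cadj_mult: "cadj (A ** B) = cadj B ** cadj A"
  by (simp add: cadj_def matrix_matrix_mult_def mult.commute)

lemma unitary_mat_cadj: "unitary_mat U \<Longrightarrow> unitary_mat (cadj U)"
  by (auto simp: unitary_mat_def)

lemma unitary_mat_mult:
  assumes "unitary_mat U" "unitary_mat V" shows "unitary_mat (U ** V)"
proof -
  have "(U ** V) ** (cadj V ** cadj U) = U ** (V ** cadj V) ** cadj U"
    "(cadj V ** cadj U) ** (U ** V) = cadj V ** (cadj U ** U) ** V"
    by (simp_all add: matrix_mul_assoc)
  then show ?thesis using assms by (simp add: unitary_mat_def cadj_mult)
qed

lemma cip_unitary: "unitary_mat U \<Longrightarrow> cip (U *v x) (U *v y) = cip x y"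
  by (simp add: cip_adjoint matrix_vector_mul_assoc unitary_mat_def)

lemma norm_unitary:
  assumes "unitary_mat U" shows "norm (U *v x) = norm x"
  using cip_unitary[OF assms, of x x] by (simp add: cip_self flip: of_real_power)

text \<open>A complex Householder reflection I - \<beta> v v^* with v = x - y and \<beta> = 1 /
  <v,x>; for x = y it is the identity. It is unitary iff \<beta> + cnj \<beta> = |\<beta>|^2 |v|^2
  when v is nonzero, and equal norms give |v|^2 = 2 Re <v,x>. That it fixes the complement of x - y
  allows two reflections to be composed for a pair.\<close>

lemma exists_unitary_map_vector:
  fixes x y :: "complex^'n"
  assumes "norm x = norm y"
  obtains R where "unitary_mat R" "R *v x = y" "\<And>z. cip (x - y) z = 0 \<Longrightarrow> R *v z = z"
proof -
  define v where "v = x - y"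
  define \<beta> where "\<beta> = 1 / cip v x"
  define H :: "complex \<Rightarrow> complex^'n^'n" where
    "H b = (\<chi> i j. (if i = j then 1 else 0) - b * v $ i * cnj (v $ j))" for b
  have H: "H b *v z = z - (b * cip v z) *s v" for b z
    by (simp add: vec_eq_iff H_def matrix_vector_mult_def cip_def algebra_simps sum_subtractf
        sum_distrib_left if_distrib[of "\<lambda>x. _ * x"] cong: if_cong)
  have adj: "cadj (H b) = H (cnj b)" for b
    by (simp add: H_def cadj_def vec_eq_iff)
  have vv: "cip v v = cip v x + cnj (cip v x)"
  proof -
    have "cip x x = cip y y" using assms by (simp add: cip_self)
    then show ?thesis by (simp add: cnj_cip v_def cip_diff_left cip_diff_right)
  qed
  have nz: "cip v x \<noteq> 0" if "v \<noteq> 0"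
    using vv that by (auto simp: cip_self)
  have rel: "v \<noteq> 0 \<Longrightarrow> \<beta> + cnj \<beta> = \<beta> * cnj \<beta> * cip v v"
    using nz unfolding vv \<beta>_def by (simp add: field_simps)
  have HH: "H a ** H b = mat 1" if "v \<noteq> 0 \<Longrightarrow> a + b = a * b * cip v v" for a b
  proof -
    have "H a *v (H b *v z) = z" for z
    proof (cases "v = 0")
      case True then show ?thesis by (simp add: H)
    next
      case False
      have "H a *v (H b *v z) = z - ((a + b - a * b * cip v v) * cip v z) *s v"
        by (simp add: H cip_diff_right cip_scale_right vec_eq_iff algebra_simps)
      then show ?thesis using that[OF False] by simp
    qed
    then show ?thesis by (simp add: matrix_eq matrix_vector_mul_assoc)
  qed
  have "unitary_mat (H \<beta>)"
    unfolding unitary_mat_def adj using rel by (auto intro!: HH simp: add.commute mult.commute)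
  moreover have "H \<beta> *v x = y"
  proof (cases "v = 0")
    case False
    then show ?thesis using nz by (simp add: H \<beta>_def) (simp add: v_def)
  qed (simp add: H, simp add: v_def)
  moreover have "cip (x - y) z = 0 \<Longrightarrow> H \<beta> *v z = z" for z
    by (simp add: H v_def)
  ultimately show ?thesis using that by blast
qed

text \<open>After moving a to a', a second reflection moves the image of b to b'. Equality of the
  inner products makes a' orthogonal to the reflecting vector, so a' stays fixed.\<close>

lemma exists_unitary_map_pair:
  fixes a b a' b' :: "complex^'n"
  assumes "norm a = norm a'" "norm b = norm b'" "cip a b = cip a' b'"
  obtains R where "unitary_mat R" "R *v a = a'" "R *v b = b'"
proof -
  obtain R where R: "unitary_mat R" "R *v a = a'"
    using exists_unitary_map_vector[OF assms(1)] by blast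
  have "norm (R *v b) = norm b'" using R assms by (simp add: norm_unitary)
  then obtain S where S: "unitary_mat S" "S *v (R *v b) = b'"
    "\<And>z. cip (R *v b - b') z = 0 \<Longrightarrow> S *v z = z"
    using exists_unitary_map_vector by blast
  have "cip a' (R *v b) = cip a' b'"
    using cip_unitary[OF R(1), of a b] R(2) assms(3) by simp
  then have "cip (R *v b) a' = cip b' a'"
    by (metis cnj_cip)
  then have "S *v a' = a'" by (intro S(3)) (simp add: cip_diff_left)
  then show ?thesis
    using that[of "S ** R"] R S by (simp add: unitary_mat_mult flip: matrix_vector_mul_assoc)
qed

section \<open>Invariance of the Haar measure\<close>

lemma continuous_on_matrix_mult [continuous_intros]:
  fixes f :: "'a::topological_space \<Rightarrow> complex^'n^'m" and g :: "'a \<Rightarrow> complex^'p^'n"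
  assumes "continuous_on S f" "continuous_on S g"
  shows "continuous_on S (\<lambda>x. f x ** g x)"
  unfolding matrix_matrix_mult_def by (intro continuous_intros assms)

lemma continuous_on_matrix_vector_mult [continuous_intros]:
  fixes f :: "'a::topological_space \<Rightarrow> complex^'n^'m" and g :: "'a \<Rightarrow> complex^'n"
  assumes "continuous_on S f" "continuous_on S g"
  shows "continuous_on S (\<lambda>x. f x *v g x)"
  unfolding matrix_vector_mult_def by (intro continuous_intros assms)

lemma continuous_on_cadj [continuous_intros]:
  assumes "continuous_on S f" shows "continuous_on S (\<lambda>x. cadj (f x))"
  unfolding cadj_def by (intro continuous_intros assms)

lemma closed_unitary: "closed {U :: complex^'n^'n. unitary_mat U}"
  unfolding unitary_mat_def by (intro closed_Collect_conj closed_Collect_eq continuous_intros)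

lemma compact_unitary: "compact {U :: complex^'n^'n. unitary_mat U}"
proof -
  have *: "norm (U $ i $ j) \<le> 1" if "unitary_mat U" for U :: "complex^'n^'n" and i j
    using norm_unitary[OF that, of "axis j 1"] Finite_Cartesian_Product.norm_nth_le[of "U *v axis j 1" i]
    by (simp add: matrix_vector_mult_axis)
  have "norm U \<le> real CARD('n) * real CARD('n)" if "unitary_mat U" for U :: "complex^'n^'n"
  proof -
    have "norm U \<le> (\<Sum>i\<in>UNIV. norm (U $ i))"
      unfolding norm_vec_def by (rule L2_set_le_sum) auto
    also have "\<dots> \<le> (\<Sum>i\<in>(UNIV::'n set). \<Sum>j\<in>UNIV. norm (U $ i $ j))"
      by (intro sum_mono) (subst norm_vec_def, rule L2_set_le_sum, auto)
    also have "\<dots> \<le> (\<Sum>i\<in>(UNIV::'n set). \<Sum>j\<in>(UNIV::'n set). 1)"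
      by (intro sum_mono * that)
    finally show ?thesis by simp
  qed
  then have "bounded {U :: complex^'n^'n. unitary_mat U}"
    unfolding bounded_iff by blast
  then show ?thesis using closed_unitary compact_eq_bounded_closed by blast
qed

section \<open>Integration against Haar measure\<close>

locale haar =
  fixes \<mu> :: "(complex^'n^'n) measure"
  assumes haar: "haar_unitary \<mu>"
begin

sublocale prob_space \<mu> using haar by (simp add: haar_unitary_def)

sublocale pair: pair_prob_space \<mu> \<mu> ..

lemma sets_haar [simp, measurable_cong]: "sets \<mu> = sets borel"
  using haar by (simp add: haar_unitary_def)

lemma space_haar [simp]: "space \<mu> = UNIV"
  using sets_eq_imp_space_eq[OF sets_haar] by simp

lemma emeasure_haar_UNIV [simp]: "emeasure \<mu> UNIV = 1"
  using emeasure_space_1 by simp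

lemma AE_unitary: "AE U in \<mu>. unitary_mat U"
proof -
  have "prob {U. unitary_mat U} = 1" using haar by (simp add: haar_unitary_def)
  from AE_prob_1[OF this] show ?thesis by simp
qed

lemma left_invariant: "unitary_mat V \<Longrightarrow> distr \<mu> \<mu> (\<lambda>U. V ** U) = \<mu>"
  using haar by (simp add: haar_unitary_def)

lemma borel_measurable_continuous:
  fixes F :: "complex^'n^'n \<Rightarrow> 'b::topological_space"
  assumes "continuous_on UNIV F" shows "F \<in> borel_measurable \<mu>"
  using borel_measurable_continuous_onI[OF assms] by simp

lemma borel_measurable_continuous_pair:
  fixes F :: "(complex^'n^'n) \<times> (complex^'n^'n) \<Rightarrow> 'b::topological_space"
  assumes "continuous_on UNIV F" shows "F \<in> borel_measurable (\<mu> \<Otimes>\<^sub>M \<mu>)"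
proof -
  have "sets (\<mu> \<Otimes>\<^sub>M \<mu>) = sets (borel \<Otimes>\<^sub>M borel)"
    by (intro sets_pair_measure_cong) simp_all
  then have "sets (\<mu> \<Otimes>\<^sub>M \<mu>) = sets borel" unfolding borel_prod .
  then show ?thesis
    using borel_measurable_continuous_onI[OF assms] measurable_cong_sets by blast
qed

text \<open>F may be unbounded on the space of all matrices, but \<mu> is concentrated on the
  compact unitary group, where F is bounded.\<close>

lemma integrable_continuous:
  fixes F :: "complex^'n^'n \<Rightarrow> real"
  assumes "continuous_on UNIV F" shows "integrable \<mu> F"
proof -
  have "compact (F ` {U. unitary_mat U})"
    using assms compact_unitary by (meson compact_continuous_image continuous_on_subset subset_UNIV)
  then obtain B where B: "\<And>U. unitary_mat U \<Longrightarrow> norm (F U) \<le> B"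
    by (force dest!: compact_imp_bounded simp: bounded_iff)
  show ?thesis
    by (rule integrable_const_bound[of _ B])
       (use AE_unitary B assms in \<open>auto elim!: eventually_mono intro: borel_measurable_continuous\<close>)
qed

lemma nn_integral_left:
  assumes "unitary_mat V" and [measurable]: "F \<in> borel_measurable \<mu>"
  shows "(\<integral>\<^sup>+ U. F (V ** U) \<partial>\<mu>) = (\<integral>\<^sup>+ U. F U \<partial>\<mu>)"
proof -
  have [measurable]: "(\<lambda>U. V ** U) \<in> measurable \<mu> \<mu>"
    using borel_measurable_continuous_onI[of "\<lambda>U::complex^'n^'n. V ** U"]
    by (simp add: measurable_cong_sets[OF sets_haar sets_haar] continuous_intros)
  show ?thesis
    by (subst (2) left_invariant[OF assms(1), symmetric]) (simp add: nn_integral_distr)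
qed

text \<open>Integrating \<open>F (U\<^sup>* W)\<close> over \<open>W\<close> first or over \<open>U\<close> first gives the two sides.\<close>
lemma nn_integral_cadj:
  assumes F: "F \<in> borel_measurable borel"
  shows "(\<integral>\<^sup>+ U. F (cadj U) \<partial>\<mu>) = (\<integral>\<^sup>+ U. F U \<partial>\<mu>)"
proof -
  have [measurable]: "F \<in> borel_measurable \<mu>" using F by simp
  have cm [measurable]: "(\<lambda>U. F (cadj U)) \<in> borel_measurable \<mu>"
    by (rule measurable_compose[OF _ F]) (intro borel_measurable_continuous continuous_intros)
  have "(\<lambda>p. F (cadj (fst p) ** snd p)) \<in> borel_measurable (\<mu> \<Otimes>\<^sub>M \<mu>)"
    by (rule measurable_compose[OF _ F]) (intro borel_measurable_continuous_pair continuous_intros)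
  then have m: "(\<lambda>(U, W). F (cadj U ** W)) \<in> borel_measurable (\<mu> \<Otimes>\<^sub>M \<mu>)"
    by (simp add: case_prod_beta)
  have "(\<integral>\<^sup>+ U. F U \<partial>\<mu>) = (\<integral>\<^sup>+ U. (\<integral>\<^sup>+ W. F W \<partial>\<mu>) \<partial>\<mu>)"
    by simp
  also have "\<dots> = (\<integral>\<^sup>+ U. (\<integral>\<^sup>+ W. F (cadj U ** W) \<partial>\<mu>) \<partial>\<mu>)"
    using AE_unitary
    by (intro nn_integral_cong_AE) (auto elim!: eventually_mono simp: nn_integral_left unitary_mat_cadj)
  also have "\<dots> = (\<integral>\<^sup>+ W. (\<integral>\<^sup>+ U. F (cadj U ** W) \<partial>\<mu>) \<partial>\<mu>)"
    using pair.Fubini'[OF m] by simp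
  also have "\<dots> = (\<integral>\<^sup>+ W. (\<integral>\<^sup>+ U. F (cadj U) \<partial>\<mu>) \<partial>\<mu>)"
  proof (intro nn_integral_cong_AE, use AE_unitary in eventually_elim)
    fix W :: "complex^'n^'n" assume "unitary_mat W"
    from nn_integral_left[OF unitary_mat_cadj[OF this] cm]
    show "(\<integral>\<^sup>+ U. F (cadj U ** W) \<partial>\<mu>) = (\<integral>\<^sup>+ U. F (cadj U) \<partial>\<mu>)"
      by (simp add: cadj_mult)
  qed
  finally show ?thesis by simp
qed

text \<open>\<open>haar_unitary\<close> provides left invariance only; passing to adjoints turns
  right multiplication by V into left multiplication by \<open>cadj V\<close>.\<close>

lemma nn_integral_right:
  assumes V: "unitary_mat V" and F: "F \<in> borel_measurable borel"
  shows "(\<integral>\<^sup>+ U. F (U ** V) \<partial>\<mu>) = (\<integral>\<^sup>+ U. F U \<partial>\<mu>)"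
proof -
  have FV: "(\<lambda>U. F (U ** V)) \<in> borel_measurable borel"
    by (rule measurable_compose[OF _ F]) (intro borel_measurable_continuous_onI continuous_intros)
  have Fc: "(\<lambda>U. F (cadj U)) \<in> borel_measurable \<mu>"
    by (rule measurable_compose[OF _ F]) (intro borel_measurable_continuous continuous_intros)
  have "(\<integral>\<^sup>+ U. F (U ** V) \<partial>\<mu>) = (\<integral>\<^sup>+ U. F (cadj (cadj V ** U)) \<partial>\<mu>)"
    using nn_integral_cadj[OF FV] by (simp add: cadj_mult)
  also have "\<dots> = (\<integral>\<^sup>+ U. F U \<partial>\<mu>)"
    using nn_integral_left[OF unitary_mat_cadj[OF V] Fc] nn_integral_cadj[OF F] by simp
  finally show ?thesis .
qed

lemma expectation_right:
  fixes F :: "complex^'n^'n \<Rightarrow> real"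
  assumes V: "unitary_mat V" and F: "continuous_on UNIV F" "\<And>U. 0 \<le> F U"
  shows "expectation (\<lambda>U. F (U ** V)) = expectation F"
proof -
  have "continuous_on UNIV (\<lambda>U. F (U ** V))"
    by (rule continuous_on_compose2[OF F(1)]) (auto intro!: continuous_intros)
  then show ?thesis
    using nn_integral_right[OF V, of "\<lambda>U. ennreal (F U)"] F
    by (simp add: integral_eq_nn_integral borel_measurable_continuous borel_measurable_continuous_onI)
qed

text \<open>The joint law of U a and U b depends only on the Gram data of (a, b): two pairs with the
  same data differ by a unitary R, which right invariance absorbs. All later changes of direction go
  through this lemma.\<close>

lemma expectation_pair_cong:
  fixes G :: "(complex^'n) \<times> (complex^'n) \<Rightarrow> real"
  assumes ab: "norm a = norm a'" "norm b = norm b'" "cip a b = cip a' b'"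
    and G: "continuous_on UNIV G" "\<And>p. 0 \<le> G p"
  shows "expectation (\<lambda>U. G (U *v a, U *v b)) = expectation (\<lambda>U. G (U *v a', U *v b'))"
proof -
  obtain R where R: "unitary_mat R" "R *v a = a'" "R *v b = b'"
    using exists_unitary_map_pair[OF ab] .
  have "continuous_on UNIV (\<lambda>U. G (U *v a, U *v b))"
    by (rule continuous_on_compose2[OF G(1)]) (auto intro!: continuous_intros)
  from expectation_right[OF R(1) this G(2)] show ?thesis
    using R by (simp flip: matrix_vector_mul_assoc)
qed

end

section \<open>The quadratic form of an observable\<close>

lemma finite_tidx [simp]: "finite (tidx k :: 'n::finite list set)"
  unfolding tidx_def using finite_lists_length_eq[of "UNIV :: 'n set" k] by simp

text \<open>The distributive law, by splitting off the first letter of a word. Applied to squared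
  moduli it makes the norm of a product tensor multiplicative.\<close>

lemma sum_prod_tidx:
  fixes g :: "nat \<Rightarrow> 'n::finite \<Rightarrow> 'a::comm_semiring_1"
  shows "(\<Sum>xs\<in>tidx k. \<Prod>i<k. g i (xs ! i)) = (\<Prod>i<k. \<Sum>x\<in>UNIV. g i x)"
proof (induction k arbitrary: g)
  case 0
  have "tidx 0 = {[] :: 'n list}" by (auto simp: tidx_def)
  then show ?case by simp
next
  case (Suc k)
  have eq: "tidx (Suc k) = (\<lambda>(x, xs). x # xs) ` ((UNIV :: 'n set) \<times> tidx k)"
    by (auto simp: tidx_def image_iff length_Suc_conv)
  have "(\<Sum>xs\<in>tidx (Suc k). \<Prod>i<Suc k. g i (xs ! i))
      = (\<Sum>(x, xs)\<in>(UNIV :: 'n set) \<times> tidx k. g 0 x * (\<Prod>i<k. g (Suc i) (xs ! i)))"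
    unfolding eq
    by (subst sum.reindex) (auto simp: inj_on_def prod.lessThan_Suc_shift case_prod_beta simp del: prod.lessThan_Suc)
  also have "\<dots> = (\<Sum>x\<in>UNIV. g 0 x) * (\<Sum>xs\<in>tidx k. \<Prod>i<k. g (Suc i) (xs ! i))"
    by (simp add: sum_product sum.cartesian_product)
  also have "\<dots> = (\<Prod>i<Suc k. \<Sum>x\<in>UNIV. g i x)"
    unfolding Suc.IH[of "\<lambda>i. g (Suc i)"] by (simp add: prod.lessThan_Suc_shift del: prod.lessThan_Suc)
  finally show ?case .
qed

definition l2 :: "nat \<Rightarrow> ('n list \<Rightarrow> complex) \<Rightarrow> real" where
  "l2 k a = L2_set (\<lambda>xs. cmod (a xs)) (tidx k)"

lemma l2_nonneg [simp]: "0 \<le> l2 k a"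
  by (simp add: l2_def)

lemma l2_sum:
  assumes "finite I"
  shows "l2 k (\<lambda>xs. \<Sum>i\<in>I. a i xs) \<le> (\<Sum>i\<in>I. l2 k (a i))"
  using assms
proof induction
  case empty
  then show ?case by (simp add: l2_def L2_set_def)
next
  case (insert i I)
  have "l2 k (\<lambda>xs. \<Sum>j\<in>insert i I. a j xs)
      \<le> L2_set (\<lambda>xs. cmod (a i xs) + cmod (\<Sum>j\<in>I. a j xs)) (tidx k)"
    unfolding l2_def using insert.hyps by (intro L2_set_mono) (auto intro: norm_triangle_ineq)
  also have "\<dots> \<le> l2 k (a i) + l2 k (\<lambda>xs. \<Sum>j\<in>I. a j xs)"
    unfolding l2_def by (rule L2_set_triangle_ineq)
  finally show ?case using insert by simp
qed

lemma l2_prod: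
  fixes v :: "nat \<Rightarrow> complex^'n"
  shows "l2 k (\<lambda>xs. \<Prod>i<k. v i $ (xs ! i)) = (\<Prod>i<k. norm (v i))"
proof -
  have "(l2 k (\<lambda>xs. \<Prod>i<k. v i $ (xs ! i)))\<^sup>2 = (\<Sum>xs\<in>tidx k. \<Prod>i<k. (cmod (v i $ (xs ! i)))\<^sup>2)"
    by (simp add: l2_def L2_set_def sum_nonneg prod_nonneg prod_power_distrib flip: prod_norm)
  also have "\<dots> = (\<Prod>i<k. norm (v i))\<^sup>2"
  proof -
    have "(\<Sum>x\<in>UNIV. (cmod (v i $ x))\<^sup>2) = (norm (v i))\<^sup>2" for i
      by (simp add: norm_vec_def L2_set_def sum_nonneg)
    then show ?thesis
      using sum_prod_tidx[where k=k and g="\<lambda>i x. (cmod (v i $ x))\<^sup>2"] by (simp add: prod_power_distrib)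
  qed
  finally show ?thesis
    by (simp add: prod_nonneg)
qed

definition opform :: "nat \<Rightarrow> 'n kop \<Rightarrow> ('n list \<Rightarrow> complex) \<Rightarrow> ('n list \<Rightarrow> complex) \<Rightarrow> complex" where
  "opform k Q a b = (\<Sum>xs\<in>tidx k. cnj (a xs) * apply_op k Q b xs)"

text \<open>Cauchy-Schwarz, followed by the operator norm bound for Q.\<close>

lemma opform_bound:
  assumes "Q \<in> obs k"
  shows "cmod (opform k Q a b) \<le> l2 k a * l2 k b"
proof -
  have "cmod (opform k Q a b) \<le> (\<Sum>xs\<in>tidx k. \<bar>cmod (a xs)\<bar> * \<bar>cmod (apply_op k Q b xs)\<bar>)"
    unfolding opform_def by (rule sum_norm_le) (simp add: norm_mult)
  also have "\<dots> \<le> l2 k a * l2 k (apply_op k Q b)"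
    unfolding l2_def by (rule L2_set_mult_ineq)
  also have "l2 k (apply_op k Q b) \<le> l2 k b"
    using assms by (simp add: obs_def opnorm_le1_def l2_def L2_set_def)
  finally show ?thesis by (simp add: mult_left_mono)
qed

section \<open>Tensor powers and the derivative of the quadratic form\<close>

definition tvec :: "nat \<Rightarrow> complex^'n \<Rightarrow> 'n list \<Rightarrow> complex" where
  "tvec k v xs = (\<Prod>i<k. v $ (xs ! i))"

text \<open>The Leibniz rule for the k-fold tensor power: the derivative of \<open>tvec k\<close> at
  v in direction h, with h put into one tensor slot at a time.\<close>

definition dtvec :: "nat \<Rightarrow> complex^'n \<Rightarrow> complex^'n \<Rightarrow> 'n list \<Rightarrow> complex" where
  "dtvec k v h xs = (\<Sum>i<k. h $ (xs ! i) * (\<Prod>j\<in>{..<k} - {i}. v $ (xs ! j)))"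

definition qform :: "nat \<Rightarrow> 'n kop \<Rightarrow> complex^'n \<Rightarrow> real" where
  "qform k Q v = Re (opform k Q (tvec k v) (tvec k v))"

definition dqform :: "nat \<Rightarrow> 'n kop \<Rightarrow> complex^'n \<Rightarrow> complex^'n \<Rightarrow> real" where
  "dqform k Q v h = Re (opform k Q (dtvec k v h) (tvec k v) + opform k Q (tvec k v) (dtvec k v h))"

text \<open>The k-fold power of a rank-one projector is the projector onto the tensor power, so the
  trace is a diagonal value of the form. It is real because Q is Hermitian, hence the
  \<open>Re\<close> in \<open>qform\<close> loses nothing.\<close>

lemma tr_prod_eq_qform:
  assumes "Q \<in> obs k"
  shows "tr_prod k (tensor_pow k (rho i0 U)) Q = of_real (qform k Q (U *v axis i0 1))"
proof -
  let ?t = "tvec k (U *v axis i0 1)"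
  have herm: "cnj (Q xs ys) = Q ys xs" if "xs \<in> tidx k" "ys \<in> tidx k" for xs ys
  proof -
    have "\<forall>xs\<in>tidx k. \<forall>ys\<in>tidx k. Q xs ys = cnj (Q ys xs)"
      using assms unfolding obs_def hermitian_op_def by blast
    from this[THEN bspec, OF that(2), THEN bspec, OF that(1)] show ?thesis by (rule sym)
  qed
  have "tensor_pow k (rho i0 U) xs ys = ?t xs * cnj (?t ys)" for xs ys
    by (simp add: tensor_pow_def rho_def tvec_def matrix_vector_mult_axis prod.distrib)
  then have "tr_prod k (tensor_pow k (rho i0 U)) Q
      = (\<Sum>xs\<in>tidx k. \<Sum>ys\<in>tidx k. cnj (?t ys) * (Q ys xs * ?t xs))"
    by (simp add: tr_prod_def mult_ac)
  also have "\<dots> = opform k Q ?t ?t"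
    unfolding opform_def apply_op_def sum_distrib_left by (rule sum.swap)
  finally have tr: "tr_prod k (tensor_pow k (rho i0 U)) Q = opform k Q ?t ?t" .
  have "cnj (opform k Q ?t ?t) = (\<Sum>xs\<in>tidx k. \<Sum>ys\<in>tidx k. ?t xs * (cnj (Q xs ys) * cnj (?t ys)))"
    by (simp add: opform_def apply_op_def sum_distrib_left)
  also have "\<dots> = (\<Sum>xs\<in>tidx k. \<Sum>ys\<in>tidx k. cnj (?t ys) * (Q ys xs * ?t xs))"
    by (intro sum.cong refl) (simp add: herm mult_ac)
  also have "\<dots> = opform k Q ?t ?t"
    unfolding opform_def apply_op_def sum_distrib_left by (rule sum.swap)
  finally have "opform k Q ?t ?t \<in> \<real>" by (simp add: Reals_cnj_iff)
  then show ?thesis by (simp add: tr qform_def)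
qed

lemma has_derivative_tvec:
  "((\<lambda>v. tvec k v xs) has_derivative (\<lambda>h. dtvec k v h xs)) (at v)"
  unfolding tvec_def dtvec_def
  by (intro has_derivative_prod bounded_linear_imp_has_derivative bounded_linear_vec_nth)

lemma has_derivative_qform: "(qform k Q has_derivative dqform k Q v) (at v)"
proof -
  have "((\<lambda>v. \<Sum>xs\<in>tidx k. cnj (tvec k v xs) * (\<Sum>ys\<in>tidx k. Q xs ys * tvec k v ys)) has_derivative
      (\<lambda>h. \<Sum>xs\<in>tidx k. cnj (tvec k v xs) * (\<Sum>ys\<in>tidx k. Q xs ys * dtvec k v h ys)
         + cnj (dtvec k v h xs) * (\<Sum>ys\<in>tidx k. Q xs ys * tvec k v ys))) (at v)"
    by (intro has_derivative_sum has_derivative_mult has_derivative_mult_right has_derivative_cnj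
        has_derivative_tvec)
  from has_derivative_Re[OF this] show ?thesis
    unfolding qform_def [abs_def] dqform_def [abs_def] opform_def apply_op_def
    by (simp add: sum.distrib add.commute)
qed

lemma linear_dqform: "linear (dqform k Q v)"
  using has_derivative_qform by (rule has_derivative_linear)

lemma continuous_on_qform [continuous_intros]:
  assumes "continuous_on S f" shows "continuous_on S (\<lambda>x. qform k Q (f x))"
  unfolding qform_def opform_def apply_op_def tvec_def by (intro continuous_intros assms)

lemma continuous_on_dqform [continuous_intros]:
  assumes "continuous_on S f" "continuous_on S g"
  shows "continuous_on S (\<lambda>x. dqform k Q (f x) (g x))"
  unfolding dqform_def opform_def apply_op_def tvec_def dtvec_def
  by (intro continuous_intros assms)

text \<open>Each of the k summands of \<open>dtvec\<close> is a product tensor of norm |h|, since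
  all other slots hold the unit vector v. The factor 2 comes from the two arguments of the
  form.\<close>

lemma abs_dqform_le:
  assumes Q: "Q \<in> obs k" and v: "norm v = 1"
  shows "\<bar>dqform k Q v h\<bar> \<le> 2 * real k * norm h"
proof -
  have t: "l2 k (tvec k v) = 1"
    using l2_prod[of k "\<lambda>_. v"] v by (simp add: tvec_def[abs_def])
  have "l2 k (dtvec k v h) \<le> (\<Sum>i<k. l2 k (\<lambda>xs. h $ (xs ! i) * (\<Prod>j\<in>{..<k} - {i}. v $ (xs ! j))))"
    unfolding dtvec_def[abs_def] by (rule l2_sum) simp
  also have "\<dots> = (\<Sum>i<k. norm h)"
  proof (intro sum.cong refl)
    fix i assume "i \<in> {..<k}"
    then have i: "{..<k} \<inter> - {i} = {..<k} - {i}" "{..<k} \<inter> {i} = {i}" by auto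
    have "(\<lambda>xs. h $ (xs ! i) * (\<Prod>j\<in>{..<k} - {i}. v $ (xs ! j)))
        = (\<lambda>xs. \<Prod>j<k. (if j = i then h else v) $ (xs ! j))"
      using \<open>i \<in> {..<k}\<close> by (subst prod.remove[of _ i]) (auto intro!: ext prod.cong)
    then show "l2 k (\<lambda>xs. h $ (xs ! i) * (\<Prod>j\<in>{..<k} - {i}. v $ (xs ! j))) = norm h"
      using \<open>i \<in> {..<k}\<close> v l2_prod[of k "\<lambda>j. if j = i then h else v"]
      by (simp add: if_distrib[of norm] prod.If_cases i Collect_conv_if)
  qed
  finally have d: "l2 k (dtvec k v h) \<le> real k * norm h" by simp
  have "\<bar>dqform k Q v h\<bar> \<le> cmod (opform k Q (dtvec k v h) (tvec k v)) + cmod (opform k Q (tvec k v) (dtvec k v h))"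
    unfolding dqform_def using abs_Re_le_cmod norm_triangle_ineq order_trans by blast
  also have "\<dots> \<le> 2 * (real k * norm h)"
    using opform_bound[OF Q, of "dtvec k v h" "tvec k v"] opform_bound[OF Q, of "tvec k v" "dtvec k v h"] t d
    by simp
  finally show ?thesis by simp
qed

text \<open>The phase c^k of the right argument cancels against its conjugate from the left one.
  This later permits rotating a vector until a chosen coordinate is nonnegative.\<close>

lemma qform_scale: "cmod c = 1 \<Longrightarrow> qform k Q (c *s v) = qform k Q v"
proof -
  assume c: "cmod c = 1"
  have t: "tvec k (c *s v) xs = c ^ k * tvec k v xs" for xs
    by (simp add: tvec_def prod.distrib)
  have "cnj (c ^ k) * c ^ k = 1"
    using c by (simp add: mult.commute flip: complex_norm_square power_mult_distrib)
  then have *: "cnj (c ^ k * a) * (q * (c ^ k * b)) = cnj a * (q * b)" for a b q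
    by (metis (no_types, opaque_lifting) complex_cnj_mult mult.assoc mult.left_commute mult_1)
  show ?thesis
    unfolding qform_def opform_def apply_op_def t sum_distrib_left * ..
qed

section \<open>Concentration\<close>

text \<open>The bound cosh x <= exp (x^2 / 2). After taking logarithms, the difference has
  derivative y - tanh y, and y cosh y - sinh y is nondecreasing from 0 for y >= 0.\<close>

lemma exp_plus_exp_minus_le: "exp x + exp (- x) \<le> 2 * exp (x\<^sup>2 / 2)" for x :: real
proof -
  have *: "exp x + exp (- x) \<le> 2 * exp (x\<^sup>2 / 2)" if "0 \<le> x" for x :: real
  proof -
    have t: "exp y - exp (- y) \<le> y * (exp y + exp (- y))" if "0 \<le> y" for y :: real
    proof -
      have "(\<lambda>y. y * (exp y + exp (- y)) - (exp y - exp (- y))) 0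
          \<le> (\<lambda>y. y * (exp y + exp (- y)) - (exp y - exp (- y))) y"
      proof (rule DERIV_nonneg_imp_nondecreasing[OF that])
        fix z :: real assume "0 \<le> z"
        have "((\<lambda>y. y * (exp y + exp (- y)) - (exp y - exp (- y))) has_real_derivative
            z * (exp z - exp (- z))) (at z)"
          by (rule derivative_eq_intros refl | simp add: algebra_simps)+
        moreover have "0 \<le> z * (exp z - exp (- z))" using \<open>0 \<le> z\<close> by simp
        ultimately show "\<exists>d. ((\<lambda>y. y * (exp y + exp (- y)) - (exp y - exp (- y))) has_real_derivative d) (at z) \<and> 0 \<le> d"
          by blast
      qed
      then show ?thesis by simp
    qed
    have "(\<lambda>y. y\<^sup>2 / 2 - ln (exp y + exp (- y))) 0 \<le> (\<lambda>y. y\<^sup>2 / 2 - ln (exp y + exp (- y))) x"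
    proof (rule DERIV_nonneg_imp_nondecreasing[OF that])
      fix y :: real assume "0 \<le> y"
      have pos: "0 < exp y + exp (- y)" by (simp add: add_pos_pos)
      have "((\<lambda>y. y\<^sup>2 / 2 - ln (exp y + exp (- y))) has_real_derivative
          y - (exp y - exp (- y)) / (exp y + exp (- y))) (at y)"
        using pos by (auto intro!: derivative_eq_intros simp: divide_simps) (simp add: algebra_simps)
      moreover have "0 \<le> y - (exp y - exp (- y)) / (exp y + exp (- y))"
        using t[OF \<open>0 \<le> y\<close>] pos by (simp add: pos_divide_le_eq)
      ultimately show "\<exists>z. ((\<lambda>y. y\<^sup>2 / 2 - ln (exp y + exp (- y))) has_real_derivative z) (at y) \<and> 0 \<le> z"
        by blast
    qed
    then have "ln (exp x + exp (- x)) \<le> ln (2 * exp (x\<^sup>2 / 2))"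
      by (simp add: ln_mult)
    then show ?thesis by (simp add: add_pos_pos)
  qed
  show ?thesis
    using *[of x] *[of "- x"] by (cases "0 \<le> x") (auto simp: add.commute)
qed

section \<open>Derivatives along random columns and Rademacher sums\<close>

lemma linear_matrix_vector_mult: "linear (\<lambda>x. (U :: complex^'n^'m) *v x)"
  by (rule linearI)
     (simp_all add: vec_eq_iff matrix_vector_mult_def scaleR_sum_right distrib_left sum.distrib)

lemma sum_scaleR_axis_nth:
  "(\<Sum>j\<in>J. c j *\<^sub>R axis j 1 :: complex^'n) $ i = (if i \<in> J then of_real (c i) else 0)"
proof -
  have "(\<Sum>j\<in>J. c j *\<^sub>R axis j 1 :: complex^'n) $ i = (\<Sum>j\<in>J. if i = j then of_real (c j) else 0)"
    unfolding sum_component vector_scaleR_component axis_def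
    by (intro sum.cong) (auto simp: scaleR_conv_of_real)
  then show ?thesis by simp
qed

lemma norm_sum_scaleR_axis: "(norm (\<Sum>j\<in>J. c j *\<^sub>R axis j 1 :: complex^'n))\<^sup>2 = (\<Sum>j\<in>J. (c j)\<^sup>2)"
proof -
  have "(norm (\<Sum>j\<in>J. c j *\<^sub>R axis j 1 :: complex^'n))\<^sup>2 = (\<Sum>i\<in>UNIV. if i \<in> J then (c i)\<^sup>2 else 0)"
    by (auto simp: norm_vec_def L2_set_def sum_nonneg sum_scaleR_axis_nth intro!: sum.cong simp del: sum_component)
  then show ?thesis by (simp add: sum.If_cases)
qed

lemma dqform_sum:
  "dqform k Q v (U *v (\<Sum>j\<in>J. c j *\<^sub>R x j)) = (\<Sum>j\<in>J. c j * dqform k Q v (U *v x j))"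
proof -
  have "linear (\<lambda>x. dqform k Q v (U *v x))"
    using linear_compose[OF linear_matrix_vector_mult linear_dqform] by (simp add: o_def)
  from linear_sum[OF this, of "\<lambda>j. c j *\<^sub>R x j" J] linear_scale[OF this] show ?thesis by simp
qed

text \<open>Duality: the linear functional is tested in the direction whose coefficients are its own
  values Z j. This gives S <= 2k sqrt S for the sum of squares S.\<close>

lemma sum_dqform_squares_le:
  fixes U :: "complex^'n^'n"
  assumes Q: "Q \<in> obs k" and U: "unitary_mat U"
  shows "(\<Sum>j\<in>J. (dqform k Q (U *v axis i0 1) (U *v axis j 1))\<^sup>2) \<le> 4 * (real k)\<^sup>2"
proof -
  define Z where "Z j = dqform k Q (U *v axis i0 1) (U *v axis j 1)" for j
  define S where "S = (\<Sum>j\<in>J. (Z j)\<^sup>2)"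
  let ?d = "\<Sum>j\<in>J. Z j *\<^sub>R axis j 1 :: complex^'n"
  have "S \<ge> 0" by (simp add: S_def sum_nonneg)
  have d: "norm ?d = sqrt S"
    using norm_sum_scaleR_axis[of Z J] by (simp add: S_def real_sqrt_unique)
  have "S = dqform k Q (U *v axis i0 1) (U *v ?d)"
    by (simp add: dqform_sum S_def power2_eq_square Z_def)
  also have "\<dots> \<le> 2 * real k * norm (U *v ?d)"
    using abs_dqform_le[OF Q, of "U *v axis i0 1" "U *v ?d"] by (simp add: norm_unitary[OF U])
  also have "\<dots> = 2 * real k * sqrt S" using d by (simp add: norm_unitary[OF U])
  finally have "sqrt S * sqrt S \<le> 2 * real k * sqrt S" using \<open>S \<ge> 0\<close> by simp
  then have "sqrt S \<le> 2 * real k"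
    using \<open>S \<ge> 0\<close> by (cases "S = 0") (auto dest: mult_right_le_imp_le simp del: real_sqrt_mult_self)
  then have "(sqrt S)\<^sup>2 \<le> (2 * real k)\<^sup>2" using \<open>S \<ge> 0\<close> by (intro power_mono) auto
  then show ?thesis using \<open>S \<ge> 0\<close> by (simp add: S_def Z_def power_mult_distrib)
qed

text \<open>A subset X encodes the sign pattern that is positive exactly on X, so the sum over all
  patterns is the expansion of the product.\<close>

lemma sum_signs_exp:
  fixes x :: "'a \<Rightarrow> real"
  assumes "finite J"
  shows "(\<Sum>X\<in>Pow J. exp (\<Sum>j\<in>J. (if j \<in> X then 1 else -1) * x j)) = (\<Prod>j\<in>J. exp (x j) + exp (- x j))"
proof -
  have "exp (\<Sum>j\<in>J. (if j \<in> X then 1 else -1) * x j) = (\<Prod>j\<in>X. exp (x j)) * (\<Prod>j\<in>J - X. exp (- x j))"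
    if "X \<in> Pow J" for X
  proof -
    have X: "X \<subseteq> J" "J \<inter> X = X" "finite X" using that assms finite_subset by auto
    have "exp (\<Sum>j\<in>J. (if j \<in> X then 1 else -1) * x j)
        = (\<Prod>j\<in>J. if j \<in> X then exp (x j) else exp (- x j))"
      using assms by (auto simp: exp_sum intro!: prod.cong)
    also have "\<dots> = (\<Prod>j\<in>X. exp (x j)) * (\<Prod>j\<in>J - X. exp (- x j))"
      using assms X by (simp add: prod.If_cases Diff_eq)
    finally show ?thesis .
  qed
  then show ?thesis using assms by (simp add: prod_add)
qed

context haar begin

text \<open>Invariance allows replacing the direction \<open>e\<^sub>1\<close> by any \<open>(\<Sum>\<^sub>j \<plusminus>e\<^sub>j) / \<surd>(N - 1)\<close>, where \<open>j \<noteq> i0\<close>;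
  averaging over the signs then gives a Rademacher sum.\<close>
lemma mgf_tangent:
  assumes Q: "Q \<in> obs k" and i1: "i1 \<noteq> i0"
  shows "expectation (\<lambda>U. exp (s * dqform k Q (U *v axis i0 1) (U *v axis i1 1)))
    \<le> exp (2 * s\<^sup>2 * (real k)\<^sup>2 / (real CARD('n) - 1))" (is "?E \<le> _")
proof -
  define J where "J = UNIV - {i0}"
  define M where "M = real (card J)"
  have "i1 \<in> J" using i1 by (simp add: J_def)
  then have M1: "card J > 0" by (auto simp: card_gt_0_iff)
  then have M: "M > 0" by (simp add: M_def)
  have M_eq: "M = real CARD('n) - 1"
    using M1 by (simp add: M_def J_def card_Diff_singleton of_nat_diff)
  define Z where "Z U j = s * dqform k Q (U *v axis i0 1) (U *v axis j 1) / sqrt M" for U j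
  have contZ: "continuous_on UNIV (\<lambda>U. Z U j)" for j
    unfolding Z_def by (intro continuous_intros) (use M in auto)
  define sg :: "'n set \<Rightarrow> 'n \<Rightarrow> real" where "sg X j = (if j \<in> X then 1 else -1)" for X j
  define y where "y X = (\<Sum>j\<in>J. (sg X j / sqrt M) *\<^sub>R axis j 1 :: complex^'n)" for X
  have E: "expectation (\<lambda>U. exp (\<Sum>j\<in>J. sg X j * Z U j)) = ?E" for X
  proof -
    have "(norm (y X))\<^sup>2 = (\<Sum>j\<in>J. (sg X j / sqrt M)\<^sup>2)"
      unfolding y_def by (rule norm_sum_scaleR_axis)
    also have "\<dots> = (\<Sum>j\<in>J. 1 / M)"
      using M by (intro sum.cong) (auto simp: sg_def power_divide)
    also have "\<dots> = 1" using M1 by (auto simp: M_def)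
    finally have ny: "norm (y X) = 1"
      using norm_ge_zero[of "y X"] by (auto simp: power2_eq_1_iff)
    \<comment> \<open>Both sides vanish, as neither the axis i1 nor \<open>y X\<close> has an i0
      coordinate.\<close>
    have c: "cip (axis i0 1) (axis i1 1 :: complex^'n) = cip (axis i0 1) (y X)"
      using i1 unfolding cip_axis_left y_def sum_scaleR_axis_nth by (simp add: axis_def J_def)
    have "?E = expectation (\<lambda>U. exp (s * dqform k Q (U *v axis i0 1) (U *v y X)))"
      using expectation_pair_cong[OF refl _ c, of "\<lambda>p. exp (s * dqform k Q (fst p) (snd p))"] ny
      by (simp add: continuous_intros)
    also have "(\<lambda>U. exp (s * dqform k Q (U *v axis i0 1) (U *v y X))) = (\<lambda>U. exp (\<Sum>j\<in>J. sg X j * Z U j))"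
      unfolding y_def dqform_sum Z_def by (simp add: sum_distrib_left mult_ac)
    finally show ?thesis by simp
  qed
  have "2 ^ card J * ?E = (\<Sum>X\<in>Pow J. expectation (\<lambda>U. exp (\<Sum>j\<in>J. sg X j * Z U j)))"
    unfolding E by (simp add: card_Pow)
  also have "\<dots> = expectation (\<lambda>U. \<Sum>X\<in>Pow J. exp (\<Sum>j\<in>J. sg X j * Z U j))"
    by (rule Bochner_Integration.integral_sum[symmetric])
       (intro integrable_continuous continuous_intros contZ)
  also have "\<dots> = expectation (\<lambda>U. \<Prod>j\<in>J. exp (Z U j) + exp (- Z U j))"
    unfolding sg_def by (subst sum_signs_exp) (auto simp: J_def)
  also have "\<dots> \<le> expectation (\<lambda>U. 2 ^ card J * exp (2 * s\<^sup>2 * (real k)\<^sup>2 / M))"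
  proof (rule integral_mono_AE)
    show "integrable \<mu> (\<lambda>U. \<Prod>j\<in>J. exp (Z U j) + exp (- Z U j))"
      by (intro integrable_continuous continuous_intros contZ)
    show "AE U in \<mu>. (\<Prod>j\<in>J. exp (Z U j) + exp (- Z U j)) \<le> 2 ^ card J * exp (2 * s\<^sup>2 * (real k)\<^sup>2 / M)"
      using AE_unitary
    proof eventually_elim
      fix U :: "complex^'n^'n" assume U: "unitary_mat U"
      have "(\<Prod>j\<in>J. exp (Z U j) + exp (- Z U j)) \<le> (\<Prod>j\<in>J. 2 * exp ((Z U j)\<^sup>2 / 2))"
        by (intro prod_mono) (auto simp: exp_plus_exp_minus_le add_nonneg_nonneg)
      also have "\<dots> = 2 ^ card J * exp (\<Sum>j\<in>J. (Z U j)\<^sup>2 / 2)"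
        by (simp add: prod.distrib exp_sum J_def)
      also have "(\<Sum>j\<in>J. (Z U j)\<^sup>2 / 2)
          = s\<^sup>2 / (2 * M) * (\<Sum>j\<in>J. (dqform k Q (U *v axis i0 1) (U *v axis j 1))\<^sup>2)"
        using M by (simp add: Z_def power_divide power_mult_distrib sum_distrib_left mult_ac)
      also have "\<dots> \<le> s\<^sup>2 / (2 * M) * (4 * (real k)\<^sup>2)"
        using M by (intro mult_left_mono sum_dqform_squares_le Q U) auto
      also have "\<dots> = 2 * s\<^sup>2 * (real k)\<^sup>2 / M" by simp
      finally show "(\<Prod>j\<in>J. exp (Z U j) + exp (- Z U j)) \<le> 2 ^ card J * exp (2 * s\<^sup>2 * (real k)\<^sup>2 / M)"
        by simp
    qed
  qed simp
  also have "\<dots> = 2 ^ card J * exp (2 * s\<^sup>2 * (real k)\<^sup>2 / M)"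
    using prob_space by simp
  finally show ?thesis by (simp add: M_eq)
qed

end

section \<open>Moment bounds along a great circle\<close>

context haar begin

text \<open>The increments over equal pieces of the arc are dependent, but Jensen's inequality only
  needs them to have the same law. The rescaled first increment tends to \<alpha> times the
  tangential derivative, so \<open>mgf_tangent\<close> with s = l \<alpha> gives the bound.\<close>

lemma mgf_arc:
  fixes i0 i1 :: 'n
  assumes Q: "Q \<in> obs k" and i1: "i1 \<noteq> i0" and \<alpha>: "0 \<le> \<alpha>"
  shows "expectation (\<lambda>U. exp (l * (qform k Q (U *v (cos \<alpha> *\<^sub>R axis i0 1 + sin \<alpha> *\<^sub>R axis i1 1))
            - qform k Q (U *v axis i0 1))))
    \<le> exp (2 * (l * \<alpha>)\<^sup>2 * (real k)\<^sup>2 / (real CARD('n) - 1))"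
proof -
  define d :: "real \<Rightarrow> complex^'n" where "d t = cos t *\<^sub>R axis i0 1 + sin t *\<^sub>R axis i1 1" for t
  define d' :: "real \<Rightarrow> complex^'n" where "d' t = (- sin t) *\<^sub>R axis i0 1 + cos t *\<^sub>R axis i1 1" for t
  define f where "f U t = qform k Q (U *v d t)" for U t
  define Z where "Z U = dqform k Q (U *v axis i0 1) (U *v axis i1 1)" for U
  have cip_ax: "cip (axis i0 1) (axis i1 1 :: complex^'n) = 0" "cip (axis i1 1) (axis i0 1 :: complex^'n) = 0"
    "cip (axis i1 1) (axis i1 1 :: complex^'n) = 1" "cip (axis i0 1) (axis i0 1 :: complex^'n) = 1"
    using i1 by (auto simp only: cip_axis_left) (auto simp: axis_def)
  have cip_d: "cip (d s) (d t) = of_real (cos (t - s))" for s t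
    by (simp add: d_def cip_add_left cip_add_right cip_scaleR_left cip_scaleR_right cip_ax cos_diff mult.commute)
  have cip_d': "cip (d' t) (d' t) = 1" for t
  proof -
    have "cip (d' t) (d' t) = of_real ((sin t)\<^sup>2 + (cos t)\<^sup>2)"
      unfolding d'_def cip_add_left cip_add_right cip_scaleR_left cip_scaleR_right cip_ax
      by (simp add: power2_eq_square)
    then show ?thesis by (simp only: sin_cos_squared_add of_real_1)
  qed
  have norm_d: "norm (d t) = 1" for t
    by (rule norm_eq_1_if_cip) (simp add: cip_d)
  have norm_d': "norm (d' t) = 1" for t
    by (rule norm_eq_1_if_cip) (simp add: cip_d')
  have d0: "d 0 = axis i0 1" "d' 0 = axis i1 1" by (simp_all add: d_def d'_def)
  have f0: "f U 0 = qform k Q (U *v axis i0 1)" for U by (simp add: f_def d0)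
  have contf: "continuous_on UNIV (\<lambda>U. f U t)" for t
    unfolding f_def by (intro continuous_intros)
  have contZ: "continuous_on UNIV Z"
    unfolding Z_def by (intro continuous_intros)
  have der: "(f U has_real_derivative dqform k Q (U *v d t) (U *v d' t)) (at t)" for U t
  proof -
    have "(d has_vector_derivative d' t) (at t)"
      unfolding d_def d'_def by (auto intro!: derivative_eq_intros)
    then have "(d has_derivative (\<lambda>x. x *\<^sub>R d' t)) (at t)"
      by (simp add: has_vector_derivative_def)
    moreover have "bounded_linear (\<lambda>x. U *v x)"
      using linear_matrix_vector_mult linear_conv_bounded_linear by blast
    ultimately have "((\<lambda>t. U *v d t) has_derivative (\<lambda>x. U *v (x *\<^sub>R d' t))) (at t)"
      by (rule bounded_linear.has_derivative[rotated])
    from has_derivative_compose[OF this has_derivative_qform, of k Q]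
    have "(f U has_derivative (\<lambda>x. dqform k Q (U *v d t) (U *v (x *\<^sub>R d' t)))) (at t)"
      by (simp add: f_def[abs_def])
    moreover have "dqform k Q (U *v d t) (U *v (x *\<^sub>R d' t)) = dqform k Q (U *v d t) (U *v d' t) * x" for x
      by (simp add: linear_scale[OF linear_matrix_vector_mult] linear_scale[OF linear_dqform])
    ultimately show ?thesis by (simp add: has_field_derivative_def mult_commute_abs)
  qed
  \<comment> \<open>Supplies the constant dominating function for the limit n -> infinity.\<close>
  have lip: "\<bar>f U t - f U 0\<bar> \<le> 2 * real k * t" if "unitary_mat U" "0 \<le> t" for U t
  proof -
    have "norm (f U t - f U 0) \<le> 2 * real k * norm (t - 0)"
    proof (rule field_differentiable_bound[of UNIV])
      show "norm (dqform k Q (U *v d s) (U *v d' s)) \<le> 2 * real k" for s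
        using abs_dqform_le[OF Q, of "U *v d s" "U *v d' s"] by (simp add: norm_unitary that norm_d norm_d')
    qed (use der in auto)
    then show ?thesis using that by simp
  qed
  define F where "F n U = exp (l * real n * (f U (\<alpha> / real n) - f U 0))" for n U
  have contF: "continuous_on UNIV (F n)" for n
    unfolding F_def by (intro continuous_intros contf)
  have le: "expectation (\<lambda>U. exp (l * (f U \<alpha> - f U 0))) \<le> expectation (F n)" if "n > 0" for n
  proof -
    define \<delta> where "\<delta> = \<alpha> / real n"
    define T where "T m U = exp (l * real n * (f U (real (Suc m) * \<delta>) - f U (real m * \<delta>)))" for m U
    have contT: "continuous_on UNIV (T m)" for m
      unfolding T_def by (intro continuous_intros contf)
    have ET: "expectation (T m) = expectation (F n)" for m
    proof -
      \<comment> \<open>Both pairs consist of unit vectors with inner product cos \<delta>.\<close>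
      have "expectation (\<lambda>U. (\<lambda>p. exp (l * real n * (qform k Q (snd p) - qform k Q (fst p))))
                (U *v d (real m * \<delta>), U *v d (real (Suc m) * \<delta>)))
          = expectation (\<lambda>U. (\<lambda>p. exp (l * real n * (qform k Q (snd p) - qform k Q (fst p))))
                (U *v d 0, U *v d \<delta>))"
        by (rule expectation_pair_cong) (auto simp: norm_d cip_d algebra_simps intro!: continuous_intros)
      then show ?thesis by (simp add: T_def[abs_def] F_def[abs_def] f_def \<delta>_def)
    qed
    have "exp (l * (f U \<alpha> - f U 0)) \<le> (\<Sum>m<n. (1 / real n) * T m U)" for U
    proof -
      have "(\<Sum>m<n. f U (real (Suc m) * \<delta>) - f U (real m * \<delta>)) = f U \<alpha> - f U 0"
        using sum_lessThan_telescope[of "\<lambda>m. f U (real m * \<delta>)" n] that by (simp add: \<delta>_def)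
      \<comment> \<open>The total difference is written as an average, with weights 1/n, of
        increments magnified by n, ready for convexity of \<open>exp\<close>.\<close>
      then have "l * (f U \<alpha> - f U 0)
          = (\<Sum>m<n. (1 / real n) *\<^sub>R (l * real n * (f U (real (Suc m) * \<delta>) - f U (real m * \<delta>))))"
        using that by (simp add: sum_distrib_left[symmetric])
      then show ?thesis
        using convex_on_sum[OF _ _ exp_convex, of "{..<n}" "\<lambda>_. 1 / real n"
            "\<lambda>m. l * real n * (f U (real (Suc m) * \<delta>) - f U (real m * \<delta>))"] that
        by (auto simp: T_def)
    qed
    then have "expectation (\<lambda>U. exp (l * (f U \<alpha> - f U 0))) \<le> expectation (\<lambda>U. \<Sum>m<n. (1 / real n) * T m U)"
      by (intro integral_mono integrable_continuous continuous_intros contf contT)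
    also have "\<dots> = (\<Sum>m<n. (1 / real n) * expectation (T m))"
      by (subst Bochner_Integration.integral_sum)
         (auto intro!: integrable_continuous continuous_intros contT)
    also have "\<dots> = expectation (F n)" using that by (simp add: ET)
    finally show ?thesis .
  qed
  have "(\<lambda>n. expectation (F n)) \<longlonglongrightarrow> expectation (\<lambda>U. exp (l * (\<alpha> * Z U)))"
  proof (rule integral_dominated_convergence)
    show "(\<lambda>U. exp (l * (\<alpha> * Z U))) \<in> borel_measurable \<mu>"
      by (intro borel_measurable_continuous continuous_intros contZ)
    show "F n \<in> borel_measurable \<mu>" for n
      by (intro borel_measurable_continuous contF)
    show "integrable \<mu> (\<lambda>U. exp (\<bar>l\<bar> * (2 * real k * \<alpha>)))" by simp
    have lim: "(\<lambda>n. F n U) \<longlonglongrightarrow> exp (l * (\<alpha> * Z U))" for U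
    proof (cases "\<alpha> = 0")
      case False
      have "((\<lambda>h. (f U (0 + h) - f U 0) / h) \<longlongrightarrow> Z U) (at 0)"
        using der[of U 0] by (simp add: DERIV_def d0 Z_def)
      moreover have "filterlim (\<lambda>n. \<alpha> / real n) (at 0) sequentially"
      proof (rule filterlim_atI)
        show "(\<lambda>n. \<alpha> / real n) \<longlonglongrightarrow> 0" by (rule lim_const_over_n)
        show "\<forall>\<^sub>F n in sequentially. \<alpha> / real n \<noteq> 0"
          using eventually_gt_at_top[of 0] by eventually_elim (use False in auto)
      qed
      ultimately have "(\<lambda>n. (f U (0 + \<alpha> / real n) - f U 0) / (\<alpha> / real n)) \<longlonglongrightarrow> Z U"
        by (rule filterlim_compose)
      then have "(\<lambda>n. exp (l * (\<alpha> * ((f U (0 + \<alpha> / real n) - f U 0) / (\<alpha> / real n))))) \<longlonglongrightarrow> exp (l * (\<alpha> * Z U))"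
        by (intro tendsto_intros)
      then show ?thesis
        using False by (simp add: F_def[abs_def] mult_ac)
    qed (simp add: F_def)
    then show "AE U in \<mu>. (\<lambda>n. F n U) \<longlonglongrightarrow> exp (l * (\<alpha> * Z U))" by simp
    show "AE U in \<mu>. norm (F n U) \<le> exp (\<bar>l\<bar> * (2 * real k * \<alpha>))" for n
      using AE_unitary
    proof eventually_elim
      fix U :: "complex^'n^'n" assume U: "unitary_mat U"
      have "l * (real n * (f U (\<alpha> / real n) - f U 0)) \<le> \<bar>l\<bar> * (real n * \<bar>f U (\<alpha> / real n) - f U 0\<bar>)"
        by (metis abs_ge_self abs_mult abs_of_nat)
      also have "\<dots> \<le> \<bar>l\<bar> * (real n * (2 * real k * (\<alpha> / real n)))"
        using \<alpha> by (intro mult_left_mono lip U) auto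
      \<comment> \<open>Domination is required for every n; at n = 0 the left side is 0.\<close>
      also have "\<dots> \<le> \<bar>l\<bar> * (2 * real k * \<alpha>)"
        using \<alpha> by (cases "n = 0") auto
      finally show "norm (F n U) \<le> exp (\<bar>l\<bar> * (2 * real k * \<alpha>))" by (simp add: F_def mult.assoc)
    qed
  qed
  then have "expectation (\<lambda>U. exp (l * (f U \<alpha> - f U 0))) \<le> expectation (\<lambda>U. exp (l * (\<alpha> * Z U)))"
    by (rule LIMSEQ_le_const) (use le in \<open>auto intro!: exI[of _ 1]\<close>)
  also have "\<dots> \<le> exp (2 * (l * \<alpha>)\<^sup>2 * (real k)\<^sup>2 / (real CARD('n) - 1))"
    using mgf_tangent[OF Q i1, of "l * \<alpha>"] by (simp add: Z_def mult.assoc)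
  finally show ?thesis by (simp add: f0) (simp add: f_def d_def)
qed

end

text \<open>A function cannot exceed its mean everywhere. This selects a realisation of one random
  vector whose value serves as the centre for the other.\<close>

lemma (in prob_space) exists_le_of_nn_integral_le:
  assumes [measurable]: "X \<in> borel_measurable M" and le: "(\<integral>\<^sup>+ x. X x \<partial>M) \<le> ennreal c"
  shows "\<exists>x\<in>space M. X x \<le> ennreal c"
proof (rule ccontr)
  assume "\<not> ?thesis"
  then have gt: "ennreal c < X x" if "x \<in> space M" for x using that by auto
  have "(\<integral>\<^sup>+ x. X x - ennreal c \<partial>M) = (\<integral>\<^sup>+ x. X x \<partial>M) - (\<integral>\<^sup>+ x. ennreal c \<partial>M)"
    by (rule nn_integral_diff) (auto simp: emeasure_space_1 intro!: AE_I2 less_imp_le gt)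
  also have "\<dots> = 0"
    using le le_less_trans[OF le ennreal_less_top]
    by (simp add: emeasure_space_1 diff_eq_0_iff_ennreal)
  finally have "AE x in M. X x - ennreal c = 0"
    by (subst (asm) nn_integral_0_iff_AE) auto
  then have "AE x in M. False"
    by (rule AE_mp) (auto intro!: AE_I2 dest: gt simp: diff_eq_0_iff_ennreal)
  then show False by simp
qed

section \<open>Arbitrary unit vectors and the tail bound\<close>

context haar begin

text \<open>As \<open>qform\<close> ignores phases, w may be rotated until its inner product with
  the axis i0 is some r >= 0. The pair then has the Gram data of an arc of angle
  \<open>arccos r\<close>, at most pi / 2. The constant uses 2 (pi / 2)^2 / (N - 1) <= pi^2 / N for
  N >= 2.\<close>

lemma mgf_unit:
  fixes i0 :: 'n and w :: "complex^'n"
  assumes Q: "Q \<in> obs k" and w: "norm w = 1"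
  shows "expectation (\<lambda>U. exp (l * (qform k Q (U *v w) - qform k Q (U *v axis i0 1))))
    \<le> exp (l\<^sup>2 * (pi\<^sup>2 * (real k)\<^sup>2 / real CARD('n)))"
proof -
  define r where "r = cmod (w $ i0)"
  \<comment> \<open>The case distinction is needed because \<open>sgn 0 = 0\<close> is not a
    phase.\<close>
  define c where "c = (if w $ i0 = 0 then 1 else cnj (sgn (w $ i0)))"
  define w' where "w' = c *s w"
  have c: "cmod c = 1" by (simp add: c_def norm_sgn)
  have w'0: "w' $ i0 = of_real r"
    by (simp add: w'_def c_def r_def sgn_eq mult.commute flip: complex_norm_square)
       (simp add: power2_eq_square)
  have "cip w' w' = cip w w"
    using c by (simp add: w'_def cip_scale_left cip_scale_right mult.assoc[symmetric] mult.commute flip: complex_norm_square)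
  then have w'1: "norm w' = 1" using w by (intro norm_eq_1_if_cip) (simp add: cip_self)
  have r: "0 \<le> r" "r \<le> 1"
    using Finite_Cartesian_Product.norm_nth_le[of w i0] w by (auto simp: r_def)
  have qw: "qform k Q (U *v w) = qform k Q (U *v w')" for U
    using qform_scale[OF c, of k Q "U *v w"] by (simp add: w'_def vector_scalar_commute)
  show ?thesis
  proof (cases "\<exists>i1. i1 \<noteq> i0")
    case True
    then obtain i1 where i1: "i1 \<noteq> i0" ..
    have "card {i0, i1} \<le> CARD('n)" by (rule card_mono) auto
    then have N: "real CARD('n) \<ge> 2" using i1 by simp
    define \<alpha> where "\<alpha> = arccos r"
    have \<alpha>: "0 \<le> \<alpha>" "\<alpha> \<le> pi / 2" "cos \<alpha> = r"
      using r arccos_le_pi2[of r] by (simp_all add: \<alpha>_def arccos_lbound)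
    define d :: "complex^'n" where "d = cos \<alpha> *\<^sub>R axis i0 1 + sin \<alpha> *\<^sub>R axis i1 1"
    have cip_ax: "cip (axis i0 1) (axis i1 1 :: complex^'n) = 0" "cip (axis i1 1) (axis i0 1 :: complex^'n) = 0"
      "cip (axis i1 1) (axis i1 1 :: complex^'n) = 1" "cip (axis i0 1) (axis i0 1 :: complex^'n) = 1"
      using i1 by (auto simp only: cip_axis_left) (auto simp: axis_def)
    have "cip d d = of_real ((sin \<alpha>)\<^sup>2 + (cos \<alpha>)\<^sup>2)"
      unfolding d_def cip_add_left cip_add_right cip_scaleR_left cip_scaleR_right cip_ax
      by (simp add: power2_eq_square)
    then have nd: "norm d = 1"
      by (intro norm_eq_1_if_cip) (simp only: sin_cos_squared_add of_real_1)
    have cd: "cip (axis i0 1) w' = cip (axis i0 1) d"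
      unfolding d_def cip_add_right cip_scaleR_right cip_ax by (simp add: cip_axis_left w'0 \<alpha>)
    have "expectation (\<lambda>U. (\<lambda>p. exp (l * (qform k Q (snd p) - qform k Q (fst p)))) (U *v axis i0 1, U *v w'))
        = expectation (\<lambda>U. (\<lambda>p. exp (l * (qform k Q (snd p) - qform k Q (fst p)))) (U *v axis i0 1, U *v d))"
      by (rule expectation_pair_cong) (auto simp: w'1 nd cd intro!: continuous_intros)
    then have "expectation (\<lambda>U. exp (l * (qform k Q (U *v w) - qform k Q (U *v axis i0 1))))
        \<le> exp (2 * (l * \<alpha>)\<^sup>2 * (real k)\<^sup>2 / (real CARD('n) - 1))"
      using mgf_arc[OF Q i1 \<alpha>(1), of l] by (simp add: qw d_def)
    also have "\<dots> \<le> exp (l\<^sup>2 * (pi\<^sup>2 * (real k)\<^sup>2 / real CARD('n)))"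
    proof -
      have "\<alpha>\<^sup>2 \<le> (pi / 2)\<^sup>2" using \<alpha> by (intro power_mono) auto
      then have "2 * \<alpha>\<^sup>2 / (real CARD('n) - 1) \<le> (pi\<^sup>2 / 2) / (real CARD('n) - 1)"
        using N by (intro divide_right_mono) (auto simp: power_divide)
      also have "\<dots> \<le> (pi\<^sup>2 / 2) / (real CARD('n) / 2)"
        using N by (intro divide_left_mono) auto
      finally have "(l\<^sup>2 * (real k)\<^sup>2) * (2 * \<alpha>\<^sup>2 / (real CARD('n) - 1)) \<le> (l\<^sup>2 * (real k)\<^sup>2) * (pi\<^sup>2 / real CARD('n))"
        by (intro mult_left_mono) auto
      then show ?thesis by (simp add: power_mult_distrib mult_ac)
    qed
    finally show ?thesis .
  next
    \<comment> \<open>In dimension one there is no second axis; the rotated w is the axis itself and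
      the exponent vanishes.\<close>
    case False
    then have U: "(UNIV :: 'n set) = {i0}" by auto
    have "r = 1" using w'1 w'0 r by (simp add: norm_vec_def L2_set_def U)
    then have "w' = axis i0 1" using w'0 False by (simp add: vec_eq_iff axis_def) metis
    then show ?thesis using prob_space by (simp add: qw)
  qed
qed

lemma concentration:
  fixes i0 :: 'n
  assumes Q: "Q \<in> obs k" and k: "k \<ge> 1" and t: "t > 0"
  shows "\<exists>g. emeasure \<mu> {U. \<bar>qform k Q (U *v axis i0 1) - g\<bar> > t}
    \<le> ennreal (2 * exp (- (real CARD('n) * t\<^sup>2 / (4 * pi\<^sup>2 * (real k)\<^sup>2))))"
proof -
  define f where "f U = qform k Q (U *v axis i0 1)" for U
  define A where "A = pi\<^sup>2 * (real k)\<^sup>2 / real CARD('n)"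
  \<comment> \<open>The minimiser of l^2 A - l t, with minimum - t^2 / (4 A) (Chernoff).\<close>
  define l where "l = t / (2 * A)"
  \<comment> \<open>Both signs are summed so that a single centre controls both tails; this is the
    source of the factor 2.\<close>
  define h where "h x = exp (l * x) + exp (- l * x)" for x :: real
  have A: "A > 0" using k by (simp add: A_def)
  then have l: "l > 0" using t by (simp add: l_def)
  have h0: "h x \<ge> 0" for x by (simp add: h_def add_nonneg_nonneg)
  have contf: "continuous_on S (\<lambda>x. f (g x))" if "continuous_on S g" for S :: "'x::topological_space set" and g
    unfolding f_def by (intro continuous_intros that)
  have conth: "continuous_on S (\<lambda>x. h (g x))" if "continuous_on S g" for S :: "'x::topological_space set" and g
    unfolding h_def by (intro continuous_intros that)
  have fUW: "f (U ** W) = qform k Q (U *v (W *v axis i0 1))" for U W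
    by (simp add: f_def matrix_vector_mul_assoc)
  have m1: "(\<lambda>(U, W). ennreal (h (f W - f U))) \<in> borel_measurable (\<mu> \<Otimes>\<^sub>M \<mu>)"
    unfolding case_prod_beta
    by (intro measurable_compose[OF borel_measurable_continuous_pair measurable_ennreal] conth continuous_intros contf)
  have m2: "(\<lambda>(U, W). ennreal (h (f (U ** W) - f U))) \<in> borel_measurable (\<mu> \<Otimes>\<^sub>M \<mu>)"
    unfolding case_prod_beta
    by (intro measurable_compose[OF borel_measurable_continuous_pair measurable_ennreal] conth continuous_intros contf)
  have m3: "(\<lambda>W. ennreal (h (f W - c))) \<in> borel_measurable \<mu>" for c
    by (intro measurable_compose[OF borel_measurable_continuous measurable_ennreal] conth continuous_intros contf)
  \<comment> \<open>Left invariance replaces the independent copy W by \<open>U ** W\<close>. After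
    exchanging the integrals, W applied to the axis is a fixed unit vector and
    \<open>mgf_unit\<close> applies.\<close>
  have "(\<integral>\<^sup>+ U. (\<integral>\<^sup>+ W. ennreal (h (f W - f U)) \<partial>\<mu>) \<partial>\<mu>)
      = (\<integral>\<^sup>+ U. (\<integral>\<^sup>+ W. ennreal (h (f (U ** W) - f U)) \<partial>\<mu>) \<partial>\<mu>)"
    using AE_unitary
    by (intro nn_integral_cong_AE, eventually_elim) (rule nn_integral_left[OF _ m3, symmetric])
  also have "\<dots> = (\<integral>\<^sup>+ W. (\<integral>\<^sup>+ U. ennreal (h (f (U ** W) - f U)) \<partial>\<mu>) \<partial>\<mu>)"
    using pair.Fubini'[OF m2] by simp
  also have "\<dots> \<le> (\<integral>\<^sup>+ W. ennreal (2 * exp (l\<^sup>2 * A)) \<partial>\<mu>)"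
  proof (intro nn_integral_mono_AE, use AE_unitary in eventually_elim)
    fix W :: "complex^'n^'n" assume "unitary_mat W"
    then have w: "norm (W *v axis i0 1) = 1" by (simp add: norm_unitary)
    have i: "integrable \<mu> (\<lambda>U. exp (c * (f (U ** W) - f U)))" for c
      by (intro integrable_continuous continuous_intros contf)
    have "integrable \<mu> (\<lambda>U. h (f (U ** W) - f U))"
      unfolding h_def by (intro Bochner_Integration.integrable_add i)
    then have "(\<integral>\<^sup>+ U. ennreal (h (f (U ** W) - f U)) \<partial>\<mu>) = ennreal (expectation (\<lambda>U. h (f (U ** W) - f U)))"
      by (intro nn_integral_eq_integral) (auto simp: h0)
    also have "expectation (\<lambda>U. h (f (U ** W) - f U)) \<le> 2 * exp (l\<^sup>2 * A)"
      using mgf_unit[OF Q w, of l i0] mgf_unit[OF Q w, of "- l" i0] i[of l] i[of "- l"]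
      by (simp add: h_def A_def fUW) (simp add: f_def)
    finally show "(\<integral>\<^sup>+ U. ennreal (h (f (U ** W) - f U)) \<partial>\<mu>) \<le> ennreal (2 * exp (l\<^sup>2 * A))"
      by (simp add: ennreal_leI)
  qed
  also have "\<dots> = ennreal (2 * exp (l\<^sup>2 * A))" by simp
  finally obtain U where U: "(\<integral>\<^sup>+ W. ennreal (h (f W - f U)) \<partial>\<mu>) \<le> ennreal (2 * exp (l\<^sup>2 * A))"
    using exists_le_of_nn_integral_le[of "\<lambda>U. \<integral>\<^sup>+ W. ennreal (h (f W - f U)) \<partial>\<mu>"] m1
    by (auto intro: borel_measurable_nn_integral)
  have fm: "f \<in> borel_measurable \<mu>"
    using borel_measurable_continuous[OF contf[of UNIV "\<lambda>x. x"]] by simp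
  have set: "{W. \<bar>f W - f U\<bar> > t} \<in> sets \<mu>"
    using fm by measurable
  have "emeasure \<mu> {W. \<bar>f W - f U\<bar> > t} = (\<integral>\<^sup>+ W. indicator {W. \<bar>f W - f U\<bar> > t} W \<partial>\<mu>)"
    using set by simp
  also have "\<dots> \<le> (\<integral>\<^sup>+ W. ennreal (exp (- (l * t))) * ennreal (h (f W - f U)) \<partial>\<mu>)"
  proof (intro nn_integral_mono)
    fix W
    have "1 \<le> exp (- (l * t)) * h (f W - f U)" if "\<bar>f W - f U\<bar> > t"
    proof -
      have "exp (l * t) \<le> exp (l * \<bar>f W - f U\<bar>)" using that l by simp
      also have "\<dots> \<le> h (f W - f U)" by (auto simp: h_def abs_if right_diff_distrib)
      finally show ?thesis by (simp add: exp_minus field_simps)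
    qed
    then show "indicator {W. \<bar>f W - f U\<bar> > t} W \<le> ennreal (exp (- (l * t))) * ennreal (h (f W - f U))"
      by (auto simp: indicator_def h0 simp flip: ennreal_mult)
  qed
  also have "\<dots> = ennreal (exp (- (l * t))) * (\<integral>\<^sup>+ W. ennreal (h (f W - f U)) \<partial>\<mu>)"
    by (rule nn_integral_cmult[OF m3])
  also have "\<dots> \<le> ennreal (exp (- (l * t))) * ennreal (2 * exp (l\<^sup>2 * A))"
    using U by (intro mult_left_mono) auto
  also have "\<dots> = ennreal (2 * exp (l\<^sup>2 * A - l * t))"
    by (simp add: exp_diff exp_minus divide_inverse mult_ac flip: ennreal_mult)
  also have "l\<^sup>2 * A - l * t = - (t\<^sup>2 / (4 * A))"
    using A by (simp add: l_def field_simps power2_eq_square)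
  also have "t\<^sup>2 / (4 * A) = real CARD('n) * t\<^sup>2 / (4 * pi\<^sup>2 * (real k)\<^sup>2)"
    by (simp add: A_def field_simps)
  finally show ?thesis by (auto simp: f_def)
qed

end

section \<open>Choice of the centre and the final bound\<close>

lemma ennreal_inverse_le_inverse:
  assumes "a \<le> ennreal r" "0 < r"
  shows "ennreal (inverse r) \<le> inverse a"
proof (cases a)
  case (real s)
  with assms have "s \<le> r" by simp
  then show ?thesis
    using real assms by (cases "s = 0") (auto simp: inverse_ennreal intro!: ennreal_leI le_imp_inverse_le)
qed (use assms in \<open>simp add: top_unique\<close>)

text \<open>Used to absorb the factor 2 of the tail bound into the exponent; already 1 + 3/4 + 9/32
  exceeds 2.\<close>

lemma two_le_exp_three_quarters: "2 \<le> exp (3 / 4 :: real)"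
  using exp_lower_Taylor_quadratic[of "3 / 4"] by (simp add: power2_eq_square)

text \<open>Provides the cells of radius \<tau> for the pigeonhole argument.\<close>

lemma interval_grid:
  fixes z \<tau> :: real
  assumes "n \<ge> 1" "0 \<le> z" "z \<le> 2 * real n * \<tau>"
  shows "\<exists>i<n. 2 * real i * \<tau> \<le> z \<and> z \<le> 2 * real (Suc i) * \<tau>"
  using assms
proof (induction n rule: nat_induct_at_least)
  case base
  then show ?case by (intro exI[of _ 0]) auto
next
  case (Suc n)
  show ?case
  proof (cases "z \<le> 2 * real n * \<tau>")
    case True
    with Suc show ?thesis using less_SucI by blast
  next
    case False
    with Suc.prems show ?thesis by (intro exI[of _ n]) auto
  qed
qed

context haar begin

text \<open>In the scale-free variable \<open>x\<close> the target is exp (- x^2 / (9 pi^3)). From x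
  = 6 on, the gap to the exponent of \<open>concentration\<close> absorbs the factor 2; below 6, the
  target is close enough to 1 for a cell of probability 1 / (2n) to suffice.\<close>

lemma exists_center:
  fixes i0 :: 'n
  assumes Q: "Q \<in> obs k" and k: "k \<ge> 1" and \<tau>: "\<tau> > 0"
  shows "\<exists>g. emeasure \<mu> {U. \<bar>qform k Q (U *v axis i0 1) - g\<bar> > \<tau>}
    \<le> ennreal (exp (- (real CARD('n) * \<tau>\<^sup>2 / (9 * pi ^ 3 * (real k)\<^sup>2))))"
proof -
  define f where "f U = qform k Q (U *v axis i0 1)" for U
  define N where "N = real CARD('n)"
  define x where "x = sqrt N * \<tau> / real k"
  have N: "N > 0" by (simp add: N_def)
  have x: "x > 0" using N \<tau> k by (simp add: x_def)
  have x2: "x\<^sup>2 = N * \<tau>\<^sup>2 / (real k)\<^sup>2"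
    using N by (simp add: x_def power_mult_distrib power_divide)
  have c: "N * \<tau>\<^sup>2 / (9 * pi ^ 3 * (real k)\<^sup>2) = x\<^sup>2 / (9 * pi ^ 3)"
    by (simp add: x2 field_simps)
  have pi: "3 \<le> pi" "3.141 \<le> pi" "pi \<le> 3.1416" using pi_approx by simp_all
  have pi3: "27 \<le> pi ^ 3" "pi ^ 3 \<le> 31.1"
    using power_mono[of 3 pi 3] power_mono[of pi "3.1416" 3] pi by (simp_all add: power3_eq_cube)
  have [measurable]: "f \<in> borel_measurable \<mu>"
    unfolding f_def by (intro borel_measurable_continuous continuous_intros)
  show ?thesis
  proof (cases "6 \<le> x")
    case True
    have "6\<^sup>2 \<le> x\<^sup>2" using True by (intro power_mono) auto
    then have x36: "36 \<le> x\<^sup>2" by simp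
    obtain g where g: "emeasure \<mu> {U. \<bar>f U - g\<bar> > \<tau>} \<le> ennreal (2 * exp (- (N * \<tau>\<^sup>2 / (4 * pi\<^sup>2 * (real k)\<^sup>2))))"
      using concentration[OF Q k \<tau>, of i0] by (auto simp: f_def N_def)
    have "N * \<tau>\<^sup>2 / (4 * pi\<^sup>2 * (real k)\<^sup>2) = x\<^sup>2 / (4 * pi\<^sup>2)"
      by (simp add: x2 field_simps)
    \<comment> \<open>At x^2 = 36 this gap equals (9 pi - 4) / pi^3, about 0.78, just above the
      required 3/4.\<close>
    also have "\<dots> - x\<^sup>2 / (9 * pi ^ 3) = x\<^sup>2 * ((9 * pi - 4) / (36 * pi ^ 3))"
      by (simp add: field_simps power2_eq_square power3_eq_cube)
    also have "\<dots> \<ge> 36 * ((9 * pi - 4) / (36 * pi ^ 3))"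
      using x36 pi by (intro mult_right_mono) auto
    also have "36 * ((9 * pi - 4) / (36 * pi ^ 3)) \<ge> 3 / 4"
      using pi pi3 by (simp add: field_simps)
    finally have *: "3 / 4 \<le> N * \<tau>\<^sup>2 / (4 * pi\<^sup>2 * (real k)\<^sup>2) - x\<^sup>2 / (9 * pi ^ 3)" .
    have "2 * exp (- (N * \<tau>\<^sup>2 / (4 * pi\<^sup>2 * (real k)\<^sup>2)))
        \<le> exp (3 / 4) * exp (- (N * \<tau>\<^sup>2 / (4 * pi\<^sup>2 * (real k)\<^sup>2)))"
      by (intro mult_right_mono two_le_exp_three_quarters) simp
    also have "\<dots> \<le> exp (- (x\<^sup>2 / (9 * pi ^ 3)))"
      unfolding exp_add[symmetric] exp_le_cancel_iff using * by linarith
    finally have "2 * exp (- (N * \<tau>\<^sup>2 / (4 * pi\<^sup>2 * (real k)\<^sup>2))) \<le> exp (- (x\<^sup>2 / (9 * pi ^ 3)))" .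
    with g show ?thesis
      unfolding c[symmetric] by (auto simp: f_def N_def intro!: exI[of _ g] elim!: order_trans intro: ennreal_leI)
  next
    case False
    \<comment> \<open>With this radius the tail bound is 2 exp (- 16 / pi^2), and 16 / pi^2 >= 3/2
      makes it at most 1/2.\<close>
    define R where "R = 8 * real k / sqrt N"
    have R: "R > 0" using k N by (simp add: R_def)
    have Rt: "R / \<tau> = 8 / x" by (simp add: R_def x_def)
    obtain g where g: "emeasure \<mu> {U. \<bar>f U - g\<bar> > R} \<le> ennreal (2 * exp (- (N * R\<^sup>2 / (4 * pi\<^sup>2 * (real k)\<^sup>2))))"
      using concentration[OF Q k R, of i0] by (auto simp: f_def N_def)
    have "N * R\<^sup>2 / (4 * pi\<^sup>2 * (real k)\<^sup>2) = 16 / pi\<^sup>2"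
      using N k by (simp add: R_def power_mult_distrib power_divide field_simps)
    moreover have "16 / pi\<^sup>2 \<ge> 3 / 4 + 3 / 4"
      using power_mono[of pi "3.1416" 2] pi by (simp add: field_simps power2_eq_square)
    ultimately have R4: "exp (3 / 4 + 3 / 4) \<le> exp (N * R\<^sup>2 / (4 * pi\<^sup>2 * (real k)\<^sup>2))" by simp
    have "2 * 2 \<le> exp (3 / 4 + 3 / 4 :: real)"
      unfolding exp_add by (intro mult_mono two_le_exp_three_quarters) auto
    also note R4
    finally have "2 * exp (- (N * R\<^sup>2 / (4 * pi\<^sup>2 * (real k)\<^sup>2))) \<le> 1 / 2"
      by (simp add: exp_minus field_simps)
    with g have "emeasure \<mu> {U. \<bar>f U - g\<bar> > R} \<le> ennreal (1 / 2)"
      by (meson ennreal_leI order_trans)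
    then have "prob {U. \<bar>f U - g\<bar> > R} \<le> 1 / 2"
      unfolding emeasure_eq_measure by (subst (asm) ennreal_le_iff) auto
    moreover have "prob {U. \<bar>f U - g\<bar> \<le> R} = 1 - prob {U. \<bar>f U - g\<bar> > R}"
      using prob_compl[of "{U. \<bar>f U - g\<bar> > R}"] by (simp add: not_less set_diff_eq)
    ultimately have half: "1 / 2 \<le> prob {U. \<bar>f U - g\<bar> \<le> R}" by simp
    \<comment> \<open>So many cells of length 2 \<tau> cover an interval of length 2 R; the
      \<open>G i\<close> below are their midpoints.\<close>
    define n where "n = nat \<lceil>R / \<tau>\<rceil>"
    have "R / \<tau> > 0" using R \<tau> by simp
    then have n: "n \<ge> 1" "R / \<tau> \<le> real n" "real n \<le> 8 / x + 1"
      using of_int_ceiling_le_add_one[of "R / \<tau>"] unfolding n_def Rt[symmetric]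
      by (auto simp: le_nat_iff Suc_le_eq of_nat_nat)
    define G where "G i = g - real n * \<tau> + (2 * real i + 1) * \<tau>" for i
    have "{U. \<bar>f U - g\<bar> \<le> R} \<subseteq> (\<Union>i<n. {U. \<bar>f U - G i\<bar> \<le> \<tau>})"
    proof
      fix U assume "U \<in> {U. \<bar>f U - g\<bar> \<le> R}"
      moreover have "R \<le> real n * \<tau>" using n \<tau> by (simp add: field_simps)
      ultimately have "0 \<le> f U - g + real n * \<tau>" "f U - g + real n * \<tau> \<le> 2 * real n * \<tau>"
        by (auto simp: abs_le_iff mult.commute[of "real n" \<tau>])
      from interval_grid[OF n(1) this] show "U \<in> (\<Union>i<n. {U. \<bar>f U - G i\<bar> \<le> \<tau>})"
        by (auto simp: G_def algebra_simps abs_le_iff)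
    qed
    then have "prob {U. \<bar>f U - g\<bar> \<le> R} \<le> prob (\<Union>i<n. {U. \<bar>f U - G i\<bar> \<le> \<tau>})"
      by (intro finite_measure_mono) auto
    also have "\<dots> \<le> (\<Sum>i<n. prob {U. \<bar>f U - G i\<bar> \<le> \<tau>})"
      by (intro finite_measure_subadditive_finite) auto
    finally have sum: "1 / 2 \<le> (\<Sum>i<n. prob {U. \<bar>f U - G i\<bar> \<le> \<tau>})" using half by simp
    have "\<exists>i<n. 1 / (2 * real n) \<le> prob {U. \<bar>f U - G i\<bar> \<le> \<tau>}"
    proof (rule ccontr)
      assume "\<not> ?thesis"
      then have "(\<Sum>i<n. prob {U. \<bar>f U - G i\<bar> \<le> \<tau>}) < (\<Sum>i<n. 1 / (2 * real n))"
        using n by (intro sum_strict_mono) (auto simp: lessThan_empty_iff)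
      then show False using sum n by simp
    qed
    then obtain i where i: "1 / (2 * real n) \<le> prob {U. \<bar>f U - G i\<bar> \<le> \<tau>}" by blast
    \<comment> \<open>Here 243 = 9 * 27 comes from pi >= 3. The next inequality amounts to 2 x (8 +
      x) <= 243, and x < 6 keeps the left side below 168.\<close>
    have "x\<^sup>2 / (9 * pi ^ 3) \<le> x\<^sup>2 / 243"
      using pi3 by (intro divide_left_mono) auto
    also have "\<dots> \<le> 1 / (2 * (8 / x + 1))"
    proof -
      have "x * (8 + x) \<le> 6 * (8 + 6)" using False x by (intro mult_mono) auto
      then have "x * (x * (8 + x)) \<le> x * 84" using x by (intro mult_left_mono) auto
      then have "x * (x * (2 * (8 + x))) \<le> x * 243" using x by (simp add: algebra_simps)
      then show ?thesis using x by (simp add: field_simps power2_eq_square)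
    qed
    also have "\<dots> \<le> 1 / (2 * real n)"
      using n x by (intro divide_left_mono) (auto intro!: mult_pos_pos add_pos_pos)
    also note i
    also have "prob {U. \<bar>f U - G i\<bar> \<le> \<tau>} = 1 - prob {U. \<bar>f U - G i\<bar> > \<tau>}"
      using prob_compl[of "{U. \<bar>f U - G i\<bar> > \<tau>}"] by (simp add: not_less set_diff_eq)
    \<comment> \<open>The passage from 1 - y to exp (- y) is the elementary bound 1 - y <= exp (-
      y).\<close>
    finally have "prob {U. \<bar>f U - G i\<bar> > \<tau>} \<le> exp (- (x\<^sup>2 / (9 * pi ^ 3)))"
      using exp_ge_add_one_self[of "- (x\<^sup>2 / (9 * pi ^ 3))"] by linarith
    then show ?thesis
      unfolding c[symmetric]
      by (intro exI[of _ "G i"]) (simp add: emeasure_eq_measure f_def N_def)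
  qed
qed

end

theorem mainTheorem11:
  fixes \<mu> :: "(complex^'n^'n) measure" and i0 :: 'n and k :: nat and \<tau> :: real
  assumes "haar_unitary \<mu>" and "k \<ge> 1" and "\<tau> > 0"
  shows "ennreal (exp (real CARD('n) * \<tau>\<^sup>2 / (9 * pi ^ 3 * (real k)\<^sup>2))) \<le> q_nt \<mu> i0 k \<tau>"
proof -
  interpret haar \<mu> using assms(1) by unfold_locales
  define c where "c = real CARD('n) * \<tau>\<^sup>2 / (9 * pi ^ 3 * (real k)\<^sup>2)"
  \<comment> \<open>One centre per observable is collected into a single function g, which is then a
    candidate in the supremum defining \<open>q_nt\<close>.\<close>
  have "\<forall>Q. \<exists>g. Q \<in> obs k \<longrightarrow>
      emeasure \<mu> {U. \<bar>qform k Q (U *v axis i0 1) - g\<bar> > \<tau>} \<le> ennreal (exp (- c))"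
    using exists_center[OF _ assms(2,3), of _ i0] by (auto simp: c_def)
  then obtain g where g: "\<And>Q. Q \<in> obs k \<Longrightarrow>
      emeasure \<mu> {U. \<bar>qform k Q (U *v axis i0 1) - g Q\<bar> > \<tau>} \<le> ennreal (exp (- c))"
    by metis
  let ?p = "\<lambda>g Q. emeasure \<mu> {U\<in>space \<mu>.
    cmod (tr_prod k (tensor_pow k (rho i0 U)) Q - complex_of_real (g Q)) > \<tau>}"
  have "(SUP Q\<in>obs k. ?p g Q) \<le> ennreal (exp (- c))"
  proof (rule SUP_least)
    fix Q :: "'n kop" assume "Q \<in> obs k"
    then show "?p g Q \<le> ennreal (exp (- c))"
      using g[of Q] by (simp add: tr_prod_eq_qform flip: of_real_diff)
  qed
  then have "ennreal (inverse (exp (- c))) \<le> inverse (SUP Q\<in>obs k. ?p g Q)"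
    by (rule ennreal_inverse_le_inverse) simp
  also have "\<dots> \<le> q_nt \<mu> i0 k \<tau>"
    unfolding q_nt_def by (rule SUP_upper) simp
  finally show ?thesis by (simp add: exp_minus c_def)
qed

end
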